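(* Let $G$ be a locally compact second countable group that is not almost unimodular, and let $\Gamma_0$ and $\Pi_0$ be two countable subgroups of $G$. Then the equivalence relation $\mathcal{R}$ on $(G,\mu_G)$ given by $$x \sim \gamma x \pi, \qquad x\in G,\ \gamma \in \Gamma_0,\ \pi \in \Pi_0,$$ is not strongly ergodic.
   Context: For a locally compact second countable group $G$, $m_G$ denotes its left Haar measure and $\mu_G$ a probability measure on $G$ equivalent to $m_G$. A locally compact group $G$ with modular function $\Delta_G : G\to\mathbb{R}_+=(0,\infty)$ is called almost unimodular if $\ker\Delta_G$ is open in $G$. A non-singular countable Borel equivalence relation $\mathcal{R}$ on a standard probability space $(X,\mu)$ has full group $[\mathcal{R}]$, the group of (non-singular) Borel automorphisms $g$ of $X$ with $(gx,x)\in\mathcal{R}$ for almost every $x$. An almost invariant sequence for $\mathcal{R}$ is a sequence of measurable sets $A_n\subset X$ with $\mu(A_n \,\Delta\, gA_n)\to 0$ for all $g\in[\mathcal{R}]$; it is trivial if $\mu(A_n)(1-\mu(A_n))\to 0$. $\mathcal{R}$ is strongly ergodic if it has no non-trivial almost invariant sequence. *)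

theory Defs
  imports "HOL-Probability.Probability"
begin

text \<open>
  The ambient topological group is a type of class \<open>topological_group_add\<close>. This is the
  library's class of topological groups; it is written additively but is not assumed to be
  commutative. So \<open>\<gamma> + x + \<pi>\<close> is the product \<open>\<gamma>x\<pi>\<close>, and \<open>0\<close> and \<open>- x\<close> are the unit and
  the inverse.
\<close>

definition is_subgroup :: "'a::group_add set \<Rightarrow> bool" where
  "is_subgroup H \<longleftrightarrow>
     0 \<in> H \<and> (\<forall>x\<in>H. \<forall>y\<in>H. x + y \<in> H) \<and> (\<forall>x\<in>H. - x \<in> H)"

text \<open>
  Regularity is not required below: on a locally compact second countable Hausdorff space,
  every Borel measure that is finite on compact sets is regular.
\<close>

definition left_haar_measure :: "'a::topological_group_add measure \<Rightarrow> bool" where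
  "left_haar_measure m \<longleftrightarrow>
     sets m = sets borel \<and>
     emeasure m UNIV \<noteq> 0 \<and>
     (\<forall>K. compact K \<longrightarrow> emeasure m K < \<infinity>) \<and>
     (\<forall>g. \<forall>E\<in>sets borel. emeasure m ((\<lambda>x. g + x) ` E) = emeasure m E)"

text \<open>
  Of the two conventions for the modular function we use \<open>m(Eg) = \<Delta>(g) m(E)\<close>; the other one
  gives \<open>1 / \<Delta>\<close>, which has the same kernel. The homomorphism property and continuity
  are consequences and need not be required.
\<close>

definition modular_function ::
    "'a::topological_group_add measure \<Rightarrow> ('a \<Rightarrow> real) \<Rightarrow> bool" where
  "modular_function m \<Delta> \<longleftrightarrow>
     (\<forall>g. 0 < \<Delta> g) \<and>
     (\<forall>g. \<forall>E\<in>sets borel. emeasure m ((\<lambda>x. x + g) ` E) = ennreal (\<Delta> g) * emeasure m E)"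

text \<open>
  The left Haar measure is unique up to a positive scalar, and \<open>\<Delta>\<close> does not depend on that
  scalar, so the quantifiers over \<open>m\<close> and \<open>\<Delta>\<close> involve no choice.
\<close>

definition almost_unimodular :: "'a::topological_group_add itself \<Rightarrow> bool" where
  "almost_unimodular G \<longleftrightarrow>
     (\<exists>(m::'a measure) \<Delta>. left_haar_measure m \<and> modular_function m \<Delta> \<and> open {g. \<Delta> g = 1})"

definition nonsingular_automorphism :: "'a measure \<Rightarrow> ('a \<Rightarrow> 'a) \<Rightarrow> bool" where
  "nonsingular_automorphism M g \<longleftrightarrow>
     bij_betw g (space M) (space M) \<and>
     g \<in> measurable M M \<and>
     the_inv_into (space M) g \<in> measurable M M \<and>
     (\<forall>E\<in>sets M. emeasure M (g ` E) = 0 \<longleftrightarrow> emeasure M E = 0)"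

definition full_group :: "'a measure \<Rightarrow> ('a \<times> 'a) set \<Rightarrow> ('a \<Rightarrow> 'a) set" where
  "full_group M R = {g. nonsingular_automorphism M g \<and> (AE x in M. (g x, x) \<in> R)}"

definition almost_invariant_sequence ::
    "'a measure \<Rightarrow> ('a \<times> 'a) set \<Rightarrow> (nat \<Rightarrow> 'a set) \<Rightarrow> bool" where
  "almost_invariant_sequence M R A \<longleftrightarrow>
     (\<forall>n. A n \<in> sets M) \<and>
     (\<forall>g\<in>full_group M R. (\<lambda>n. measure M (sym_diff (A n) (g ` A n))) \<longlonglongrightarrow> 0)"

definition trivial_sequence :: "'a measure \<Rightarrow> (nat \<Rightarrow> 'a set) \<Rightarrow> bool" where
  "trivial_sequence M A \<longleftrightarrow> (\<lambda>n. measure M (A n) * (1 - measure M (A n))) \<longlonglongrightarrow> 0"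

definition strongly_ergodic :: "'a measure \<Rightarrow> ('a \<times> 'a) set \<Rightarrow> bool" where
  "strongly_ergodic M R \<longleftrightarrow>
     (\<forall>A. almost_invariant_sequence M R A \<longrightarrow> trivial_sequence M A)"

definition two_sided_relation ::
    "'a::group_add set \<Rightarrow> 'a set \<Rightarrow> ('a \<times> 'a) set" where
  "two_sided_relation H K = {(x, \<gamma> + x + \<pi>) | x \<gamma> \<pi>. \<gamma> \<in> H \<and> \<pi> \<in> K}"

end

theory Submission
  imports Defs
begin

text \<open>
  Let \<open>f\<close> be the logarithm of the modular function, a continuous homomorphism from \<open>G\<close> to the
  reals that is non-zero on every neighbourhood of the unit. Along the orbits of the relation, \<open>f\<close>
  changes only by elements of the countable group \<open>f \<Gamma>\<^sub>0 + f \<Pi>\<^sub>0\<close>. Choose \<open>t\<^sub>n\<close> such that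
  \<open>cis (t\<^sub>n * \<theta>)\<close> tends to 1 for all \<open>\<theta>\<close> in this group. Then \<open>cos (t\<^sub>n * f x)\<close> and
  \<open>sin (t\<^sub>n * f x)\<close> are asymptotically invariant, and \<open>t\<^sub>n\<close> can be chosen so that at least one
  of them does not concentrate at a constant. Suitable superlevel sets of it form a non-trivial almost
  invariant sequence. The modular function exists because Haar measure is unique: Fubini's
  theorem shows that two left Haar measures have the same null sets and that the Radon-Nikodym
  derivative is constant.
\<close>

section \<open>Haar measure and the modular function\<close>

lemma measurable_translations [measurable]:
  fixes a :: "'a::{topological_group_add, t2_space, second_countable_topology}"
  shows "(\<lambda>x. a + x) \<in> borel_measurable borel"
    and "(\<lambda>x. x + a) \<in> borel_measurable borel"
    and "(\<lambda>x. x - a) \<in> borel_measurable borel"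
    and "(\<lambda>x. - x :: 'a) \<in> borel_measurable borel"
  by (auto intro!: borel_measurable_continuous_onI continuous_intros)

lemma translation_image_eq_vimage:
  fixes a :: "'a::group_add"
  shows "(\<lambda>x. a + x) ` E = (\<lambda>x. - a + x) -` E"
    and "(\<lambda>x. x + a) ` E = (\<lambda>x. x + - a) -` E"
proof -
  show "(\<lambda>x. a + x) ` E = (\<lambda>x. - a + x) -` E"
    by (auto simp: image_iff add.assoc[symmetric] intro!: bexI[of _ "- a + _"])
  show "(\<lambda>x. x + a) ` E = (\<lambda>x. x + - a) -` E"
    by (auto simp: image_iff add.assoc intro!: bexI[of _ "_ + - a"])
qed

lemma open_translations:
  fixes U :: "'a::{topological_group_add, t2_space} set"
  assumes "open U"
  shows "open ((\<lambda>x. a + x) ` U)" and "open ((\<lambda>x. x + a) ` U)" and "open (uminus -` U)"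
  unfolding translation_image_eq_vimage
  by (intro open_vimage[OF assms] continuous_intros)+

section \<open>Left Haar measure on a locally compact second countable group\<close>

locale haar =
  fixes m :: "'a::{topological_group_add, t2_space, second_countable_topology} measure"
  assumes lc: "locally_compact_space (euclidean :: 'a topology)"
    and haar: "left_haar_measure m"
begin

lemma sets_m [simp, measurable_cong]: "sets m = sets borel"
  using haar by (simp add: left_haar_measure_def)

lemma space_m [simp]: "space m = UNIV"
  using sets_eq_imp_space_eq[OF sets_m] by simp

lemma UNIV_nonnull: "emeasure m UNIV \<noteq> 0"
  using haar by (simp add: left_haar_measure_def)

lemma compact_finite: "compact K \<Longrightarrow> emeasure m K < \<infinity>"
  using haar by (simp add: left_haar_measure_def)

lemma emeasure_left_vimage:
  assumes "E \<in> sets borel"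
  shows "emeasure m ((\<lambda>x. a + x) -` E) = emeasure m E"
proof -
  have "emeasure m ((\<lambda>x. - a + x) ` E) = emeasure m E"
    using haar assms unfolding left_haar_measure_def by blast
  then show ?thesis by (simp add: translation_image_eq_vimage)
qed

lemma compact_neighbourhood:
  fixes x :: 'a
  obtains U K where "open U" "compact K" "x \<in> U" "U \<subseteq> K"
proof -
  have "\<exists>U K. open U \<and> compact K \<and> x \<in> U \<and> U \<subseteq> K"
    using lc by (simp add: locally_compact_space_def)
  then show thesis using that by blast
qed

text \<open>The Lindelof property turns local compactness into a countable cover by sets of finite
  measure; \<open>sigma_finite\<close>, and with it Fubini and Radon-Nikodym, rests on this.\<close>

lemma open_cover_finite:
  "\<exists>\<U> :: 'a set set. countable \<U> \<and> \<Union>\<U> = UNIV \<and>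
    (\<forall>U\<in>\<U>. open U \<and> (\<exists>K. compact K \<and> U \<subseteq> K))"
proof -
  let ?F = "{U :: 'a set. open U \<and> (\<exists>K. compact K \<and> U \<subseteq> K)}"
  obtain \<U> where U: "\<U> \<subseteq> ?F" "countable \<U>" "\<Union>\<U> = \<Union>?F"
    by (rule Lindelof[of ?F]) auto
  have "\<Union>?F = UNIV"
  proof (rule UNIV_eq_I[symmetric])
    fix x :: 'a
    obtain U K where "open U" "compact K" "x \<in> U" "U \<subseteq> K"
      by (rule compact_neighbourhood)
    then show "x \<in> \<Union>?F" by (intro UnionI[of U]) auto
  qed
  with U show ?thesis by (intro exI[of _ \<U>]) auto
qed

lemma sigma_finite: "sigma_finite_measure m"
proof -
  obtain \<U> :: "'a set set" where U: "countable \<U>" "\<Union>\<U> = UNIV"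
    "\<And>U. U \<in> \<U> \<Longrightarrow> open U" "\<forall>U\<in>\<U>. \<exists>K. compact K \<and> U \<subseteq> K"
    using open_cover_finite by metis
  have "emeasure m U \<noteq> \<infinity>" if UU: "U \<in> \<U>" for U
  proof -
    obtain K where K: "compact K" "U \<subseteq> K" using bspec[OF U(4) UU] by blast
    have "emeasure m U \<le> emeasure m K"
      using K by (intro emeasure_mono) (auto intro: borel_compact)
    then show ?thesis using compact_finite[OF K(1)] by auto
  qed
  then show ?thesis
    using U(1-3) by unfold_locales (intro exI[of _ \<U>], auto)
qed

text \<open>If every member of the countable cover were null, the whole group would be. Compact sets
  have finite measure, so \<open>K\<close> is a set whose measure can be cancelled from
  equations.\<close>

lemma compact_positive:
  obtains K where "compact K" "0 < emeasure m K"
proof -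
  obtain \<U> :: "'a set set" where U: "countable \<U>" "\<Union>\<U> = UNIV"
    "\<And>U. U \<in> \<U> \<Longrightarrow> open U" "\<forall>U\<in>\<U>. \<exists>K. compact K \<and> U \<subseteq> K"
    using open_cover_finite by metis
  have "\<exists>U\<in>\<U>. emeasure m U \<noteq> 0"
  proof (rule ccontr)
    assume "\<not> ?thesis"
    then have "(\<Union>U\<in>\<U>. U) \<in> null_sets m"
      using U by (intro null_sets_UN' ) (auto intro!: null_setsI)
    then show False using U(2) UNIV_nonnull by (simp add: null_sets_def)
  qed
  then obtain U where "U \<in> \<U>" "emeasure m U \<noteq> 0" by blast
  moreover obtain K where K: "compact K" "U \<subseteq> K" using bspec[OF U(4) calculation(1)] by blast
  moreover have "emeasure m U \<le> emeasure m K"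
    using K by (intro emeasure_mono) (auto intro: borel_compact)
  ultimately show thesis
    by (intro that[of K]) (auto simp: zero_less_iff_neq_zero)
qed

end

section \<open>Uniqueness of Haar measure\<close>

text \<open>Fubini for the set of pairs \<open>(x, y)\<close> with \<open>- x + y \<in> E\<close>.
  For fixed \<open>x\<close> the slice is a left translate of \<open>E\<close>, hence null for
  \<open>n\<close>. For fixed \<open>y\<close> it is a left translate of \<open>uminus -\<close>
  followed by \<open>E\<close>, of constant \<open>m\<close>-measure. So this constant times the
  non-zero total mass of \<open>n\<close> is 0.\<close>

lemma haar_null_uminus:
  fixes m n :: "'a::{topological_group_add, t2_space, second_countable_topology} measure"
  assumes "haar m" "haar n" and E: "E \<in> sets borel" "emeasure n E = 0"
  shows "emeasure m (uminus -` E) = 0"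
proof -
  interpret m: haar m by fact
  interpret n: haar n by fact
  interpret m: sigma_finite_measure m by (rule m.sigma_finite)
  interpret n: sigma_finite_measure n by (rule n.sigma_finite)
  interpret p: pair_sigma_finite m n ..
  let ?d = "\<lambda>p::'a \<times> 'a. - fst p + snd p"
  let ?P = "?d -` E"
  \<comment> \<open>Second countability identifies the product of the Borel algebras with the Borel
    algebra of the product, so continuity of \<open>?d\<close> gives measurability of
    \<open>?P\<close>.\<close>
  have sets_p: "sets (m \<Otimes>\<^sub>M n) = sets (borel :: ('a \<times> 'a) measure)"
    by (subst borel_prod[symmetric]) (intro sets_pair_measure_cong; simp)
  have "?d \<in> borel_measurable borel"
    by (auto intro!: borel_measurable_continuous_onI continuous_intros)
  from measurable_sets[OF this E(1)] have P: "?P \<in> sets (m \<Otimes>\<^sub>M n)"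
    by (simp only: sets_p space_borel Int_UNIV_right)
  have "emeasure (m \<Otimes>\<^sub>M n) ?P = (\<integral>\<^sup>+x. emeasure n ((\<lambda>y. - x + y) -` E) \<partial>m)"
    by (subst n.emeasure_pair_measure_alt[OF P]) (simp add: vimage_def)
  also have "\<dots> = 0" using E by (simp add: n.emeasure_left_vimage)
  finally have 0: "emeasure (m \<Otimes>\<^sub>M n) ?P = 0" .
  have "emeasure m {x. - x + y \<in> E} = emeasure m (uminus -` E)" for y
  proof -
    have "(\<lambda>x. - y + x) -` (uminus -` E) = {x. - x + y \<in> E}"
      by (auto simp: minus_add)
    moreover have "uminus -` E \<in> sets borel"
      using measurable_sets[OF measurable_translations(4) E(1)] by simp
    ultimately show ?thesis using m.emeasure_left_vimage by metis
  qed
  then have "emeasure (m \<Otimes>\<^sub>M n) ?P = emeasure m (uminus -` E) * emeasure n UNIV"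
    by (subst p.emeasure_pair_measure_alt2[OF P]) (simp add: vimage_def)
  with 0 n.UNIV_nonnull show ?thesis by simp
qed

text \<open>Inversion is applied twice: the first time it leads from \<open>n\<close> to
  \<open>m\<close>, the second time it stays within \<open>m\<close>.\<close>

lemma haar_null:
  fixes m n :: "'a::{topological_group_add, t2_space, second_countable_topology} measure"
  assumes "haar m" "haar n" and E: "E \<in> sets borel" "emeasure n E = 0"
  shows "emeasure m E = 0"
proof -
  have "uminus -` E \<in> sets borel"
    using measurable_sets[OF measurable_translations(4) E(1)] by simp
  from haar_null_uminus[OF assms(1) assms(1) this haar_null_uminus[OF assms]]
  show ?thesis by (simp add: vimage_def)
qed

text \<open>Right translations commute with left ones, so left invariance survives. Comparing this
  measure with \<open>m\<close> yields both the constancy of the density in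
  \<open>haar_unique\<close> and the modular function.\<close>

lemma haar_right_translate:
  fixes m :: "'a::{topological_group_add, t2_space, second_countable_topology} measure"
  assumes "haar m"
  shows "haar (distr m borel (\<lambda>x. x + a))"
proof -
  interpret haar m by fact
  have eq: "emeasure (distr m borel (\<lambda>x. x + a)) E = emeasure m ((\<lambda>x. x + a) -` E)"
    if "E \<in> sets borel" for E
    using that by (subst emeasure_distr) auto
  have "emeasure (distr m borel (\<lambda>x. x + a)) ((+) g ` E)
      = emeasure (distr m borel (\<lambda>x. x + a)) E" if E: "E \<in> sets borel" for g E
  proof -
    have B: "(\<lambda>x. x + a) -` E \<in> sets borel"
      using measurable_sets[OF measurable_translations(2) E] by simp
    have B2: "(\<lambda>x. - g + x) -` E \<in> sets borel"
      using measurable_sets[OF measurable_translations(1) E] by simp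
    have "(\<lambda>x. x + a) -` (\<lambda>x. - g + x) -` E = (\<lambda>x. - g + x) -` (\<lambda>x. x + a) -` E"
      by (auto simp: add.assoc)
    then show ?thesis
      unfolding translation_image_eq_vimage by (simp only: eq E B2 emeasure_left_vimage[OF B])
  qed
  moreover have "emeasure (distr m borel (\<lambda>x. x + a)) K < \<infinity>" if K: "compact K" for K
  proof -
    have "compact ((\<lambda>x. x + - a) ` K)"
      using K by (intro compact_continuous_image continuous_intros)
    then have "compact ((\<lambda>x. x + a) -` K)"
      unfolding translation_image_eq_vimage by simp
    then show ?thesis using compact_finite K by (simp add: eq borel_compact)
  qed
  ultimately show ?thesis
    using lc UNIV_nonnull by unfold_locales (auto simp: left_haar_measure_def eq)
qed

theorem haar_unique:
  fixes m n :: "'a::{topological_group_add, t2_space, second_countable_topology} measure"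
  assumes m: "haar m" and n: "haar n"
  obtains c where "\<And>E. E \<in> sets borel \<Longrightarrow> emeasure n E = c * emeasure m E"
proof -
  interpret m: haar m by fact
  interpret n: haar n by fact
  interpret m: sigma_finite_measure m by (rule m.sigma_finite)
  interpret p: pair_sigma_finite m m ..
  have ac: "absolutely_continuous m n"
    using haar_null[OF n m] by (auto simp: absolutely_continuous_def null_sets_def)
  define h where "h = RN_deriv m n"
  have h [measurable]: "h \<in> borel_measurable borel"
    using borel_measurable_RN_deriv[of m n] by (simp add: h_def)
  have dens: "density m h = n"
    using m.density_RN_deriv[OF ac] by (simp add: h_def)
  \<comment> \<open>Both sides are densities of \<open>n\<close> with respect to \<open>m\<close>,
    because \<open>m\<close> and \<open>n\<close> are invariant under translation by
    \<open>a\<close>.\<close>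
  have inv: "AE x in m. h (a + x) = h x" for a
  proof (rule m.density_unique)
    show "density m (\<lambda>x. h (a + x)) = density m h"
    proof (rule measure_eqI)
      fix E assume "E \<in> sets (density m (\<lambda>x. h (a + x)))"
      then have E [measurable]: "E \<in> sets borel" by simp
      have E' [measurable]: "(\<lambda>x. - a + x) -` E \<in> sets borel"
        using measurable_sets[OF measurable_translations(1) E] by simp
      have dm: "distr m m (\<lambda>x. a + x) = m"
        by (rule measure_eqI) (auto simp: emeasure_distr m.emeasure_left_vimage)
      have "emeasure (density m (\<lambda>x. h (a + x))) E
          = (\<integral>\<^sup>+x. h (a + x) * indicator ((\<lambda>x. - a + x) -` E) (a + x) \<partial>m)"
        by (subst emeasure_density)
          (auto intro!: nn_integral_cong simp: indicator_def add.assoc[symmetric])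
      also have "\<dots> = (\<integral>\<^sup>+x. h x * indicator ((\<lambda>x. - a + x) -` E) x \<partial>distr m m (\<lambda>x. a + x))"
        by (subst nn_integral_distr) auto
      also have "\<dots> = emeasure (density m h) ((\<lambda>x. - a + x) -` E)"
        by (simp only: dm) (subst emeasure_density; simp)
      also have "\<dots> = emeasure (density m h) E"
        by (simp add: dens n.emeasure_left_vimage)
      finally show "emeasure (density m (\<lambda>x. h (a + x))) E = emeasure (density m h) E" .
    qed simp
  qed auto
  have sets_p: "sets (m \<Otimes>\<^sub>M m) = sets (borel :: ('a \<times> 'a) measure)"
    by (subst borel_prod[symmetric]) (intro sets_pair_measure_cong; simp)
  have "(\<lambda>p::'a \<times> 'a. fst p + snd p) \<in> borel_measurable borel"
    by (auto intro!: borel_measurable_continuous_onI continuous_intros)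
  then have plus [measurable]: "(\<lambda>p::'a \<times> 'a. fst p + snd p) \<in> borel_measurable (m \<Otimes>\<^sub>M m)"
    by (simp add: measurable_cong_sets[OF sets_p refl])
  \<comment> \<open>So far the exceptional set of \<open>x\<close> depends on \<open>a\<close>.
    Fubini exchanges the quantifiers, and since \<open>m\<close> is non-zero a single
    \<open>x\<close> can be fixed that works for almost every \<open>a\<close>.\<close>
  have "AE x in m. AE a in m. h (a + x) = h x"
  proof (subst p.AE_commute[symmetric])
    have "Measurable.pred (m \<Otimes>\<^sub>M m) (\<lambda>p. h (fst p + snd p) = h (snd p))"
      by measurable
    then show "{p \<in> space (m \<Otimes>\<^sub>M m). h (fst p + snd p) = h (snd p)} \<in> sets (m \<Otimes>\<^sub>M m)"
      by (simp only: pred_def)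
  qed (use inv in auto)
  moreover have "\<not> (AE x in m. False)"
    using m.UNIV_nonnull by (simp add: AE_iff_null null_sets_def)
  ultimately obtain x where x: "AE a in m. h (a + x) = h x"
    by (metis (mono_tags, lifting) eventually_mono)
  let ?N = "{z. h z \<noteq> h x}"
  have N: "?N \<in> sets borel" by measurable
  \<comment> \<open>The choice of \<open>x\<close> says that \<open>?N\<close> is null for a right
    translate of \<open>m\<close>; this is a Haar measure, so it has the null sets of
    \<open>m\<close>.\<close>
  have "emeasure (distr m borel (\<lambda>z. z + x)) ?N = 0"
    using x N by (subst emeasure_distr) (auto simp: AE_iff_null null_sets_def vimage_def)
  then have "emeasure m ?N = 0"
    by (rule haar_null[OF m haar_right_translate[OF m] N])
  then have "AE z in m. h z = h x"
    using N by (auto simp: AE_iff_null null_sets_def)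
  then have "density m h = density m (\<lambda>_. h x)"
    by (intro density_cong) auto
  then have "emeasure n E = h x * emeasure m E" if "E \<in> sets borel" for E
    using that by (simp add: dens[symmetric] emeasure_density_const)
  then show thesis by (rule that)
qed

section \<open>Existence of the modular function\<close>

context haar
begin

theorem modular_function_exists: obtains \<Delta> where "modular_function m \<Delta>"
proof -
  have hm: "haar m" by unfold_locales
  have "\<exists>d>0. \<forall>E\<in>sets borel. emeasure m ((\<lambda>x. x + g) ` E) = ennreal d * emeasure m E" for g
  proof -
    \<comment> \<open>The sign is chosen so that \<open>?n\<close> gives \<open>E\<close> the
      \<open>m\<close>-measure of its image under right translation by \<open>g\<close>.\<close>
    let ?n = "distr m borel (\<lambda>x. x + - g)"
    have hn: "haar ?n" by (rule haar_right_translate[OF hm])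
    interpret n: haar ?n by fact
    obtain c where c: "\<And>E. E \<in> sets borel \<Longrightarrow> emeasure ?n E = c * emeasure m E"
      using haar_unique[OF hm hn] by blast
    obtain K where K: "compact K" "0 < emeasure m K" by (rule compact_positive)
    \<comment> \<open>The constant is non-zero because \<open>?n\<close> is, and finite because a
      compact set of positive \<open>m\<close>-measure has finite \<open>?n\<close>-measure.\<close>
    have "c \<noteq> 0" using n.UNIV_nonnull c[of UNIV] by auto
    moreover have "c \<noteq> top"
      using n.compact_finite[OF K(1)] c[of K] K
      by (auto simp: borel_compact ennreal_top_mult split: if_splits)
    ultimately have "0 < enn2real c" "ennreal (enn2real c) = c"
      by (auto simp: enn2real_positive_iff less_top zero_less_iff_neq_zero)
    moreover have "emeasure m ((\<lambda>x. x + g) ` E) = c * emeasure m E" if "E \<in> sets borel" for E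
      using c[OF that] that by (subst (asm) emeasure_distr)
        (auto simp: translation_image_eq_vimage)
    ultimately show ?thesis by (intro exI[of _ "enn2real c"]) auto
  qed
  then have "\<exists>\<Delta>. \<forall>g. 0 < \<Delta> g \<and> (\<forall>E\<in>sets borel.
      emeasure m ((\<lambda>x. x + g) ` E) = ennreal (\<Delta> g) * emeasure m E)"
    by (intro choice) auto
  then show thesis using that by (auto simp: modular_function_def)
qed

end

section \<open>Small translations and the measure of compact sets\<close>

context haar
begin

text \<open>Outer regularity in a form adapted to translations on both sides. Thickenings of
  \<open>K\<close> by a decreasing neighbourhood base of the unit decrease to a subset of
  \<open>K\<close>, so continuity from above brings their measures below \<open>c\<close>.\<close>

lemma compact_thickening:
  assumes K: "compact K" and c: "emeasure m K < c"
  obtains U where "open U" "0 \<in> U" "open {u + k + v |u k v. u \<in> U \<and> k \<in> K \<and> v \<in> U}"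
    "emeasure m {u + k + v |u k v. u \<in> U \<and> k \<in> K \<and> v \<in> U} < c"
proof -
  define T where "T U = {u + k + v |u k v. u \<in> U \<and> k \<in> K \<and> v \<in> U}" for U
  obtain U0 C where U0: "open U0" "compact C" "(0::'a) \<in> U0" "U0 \<subseteq> C"
    by (rule compact_neighbourhood)
  obtain A :: "nat \<Rightarrow> 'a set" where A: "\<And>i. open (A i)" "\<And>i. 0 \<in> A i"
    "\<And>S. open S \<Longrightarrow> 0 \<in> S \<Longrightarrow> eventually (\<lambda>i. A i \<subseteq> S) sequentially"
    by (rule countable_basis_at_decseq) blast
  define B where "B i = U0 \<inter> (\<Inter>j\<le>i. A j)" for i
  have B: "open (B i)" "0 \<in> B i" "B i \<subseteq> U0" "B i \<subseteq> A i" for i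
    using U0 A by (auto simp: B_def)
  have T_open: "open (T U)" if "open U" for U
  proof -
    have "T U = (\<Union>k\<in>K. \<Union>v\<in>U. (\<lambda>u. u + (k + v)) ` U)"
      by (auto simp: T_def add.assoc)
    then show ?thesis using open_translations(2)[OF that] by (simp only:) (intro open_UN ballI)
  qed
  \<comment> \<open>Continuity from above needs finite measures; all these thickenings lie in the
    compact set built from \<open>C\<close>, \<open>K\<close> and \<open>C\<close>.\<close>
  have fin: "emeasure m (T (B i)) \<noteq> \<infinity>" for i
  proof -
    let ?C = "(\<lambda>(u, k, v). u + k + v) ` (C \<times> K \<times> C)"
    have "compact ?C"
      using U0(2) K by (intro compact_continuous_image compact_Times)
        (auto intro!: continuous_intros simp: split_beta')
    moreover have "T (B i) \<subseteq> ?C"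
      using B(3)[of i] U0(4) by (force simp: T_def image_iff)
    ultimately have "emeasure m (T (B i)) \<le> emeasure m ?C" "emeasure m ?C < \<infinity>"
      by (auto intro!: emeasure_mono borel_compact compact_finite[unfolded infinity_ennreal_def])
    then show ?thesis by auto
  qed
  have dec: "decseq (\<lambda>i. T (B i))"
    by (intro monotoneI) (force simp: T_def B_def)
  have "(\<Inter>i. T (B i)) \<subseteq> K"
  proof
    fix x assume "x \<in> (\<Inter>i. T (B i))"
    then have "\<forall>i. \<exists>u k v. x = u + k + v \<and> u \<in> B i \<and> k \<in> K \<and> v \<in> B i"
      by (auto simp: T_def)
    then obtain u k v where *: "\<And>i. x = u i + k i + v i" "\<And>i. u i \<in> B i" "\<And>i. k i \<in> K"
      "\<And>i. v i \<in> B i" by metis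
    have conv: "w \<longlonglongrightarrow> 0" if "\<And>i. w i \<in> B i" for w
    proof (rule topological_tendstoI)
      fix S :: "'a set" assume "open S" "0 \<in> S"
      from A(3)[OF this] show "eventually (\<lambda>i. w i \<in> S) sequentially"
        using that B(4) by (auto elim!: eventually_mono)
    qed
    \<comment> \<open>Since \<open>u\<close> and \<open>v\<close> tend to the unit, the points
      \<open>k i\<close> of the closed set \<open>K\<close> converge to \<open>x\<close>.\<close>
    have "(\<lambda>i. - u i + x + - v i) \<longlonglongrightarrow> - 0 + x + - 0"
      by (intro tendsto_intros conv *)
    moreover have "- u i + x + - v i = k i" for i
      using *(1)[of i] by (simp add: add.assoc)
    ultimately have "k \<longlonglongrightarrow> x" by simp
    then show "x \<in> K"
      using closed_sequentially[OF compact_imp_closed[OF K]] *(3) by blast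
  qed
  then have "emeasure m (\<Inter>i. T (B i)) \<le> emeasure m K"
    using K by (intro emeasure_mono) (auto intro: borel_compact)
  with c have "emeasure m (\<Inter>i. T (B i)) < c" by simp
  moreover have "(\<lambda>i. emeasure m (T (B i))) \<longlonglongrightarrow> emeasure m (\<Inter>i. T (B i))"
    using T_open B(1) fin dec by (intro Lim_emeasure_decseq) auto
  ultimately have "eventually (\<lambda>i. emeasure m (T (B i)) < c) sequentially"
    by (intro order_tendstoD(2))
  then obtain i where "emeasure m (T (B i)) < c"
    by (auto simp: eventually_sequentially)
  then show thesis by (intro that[of "B i", folded T_def] B T_open)
qed

text \<open>Null sets of \<open>\<mu>\<close> are null for \<open>m\<close>, so a set of almost full
  \<open>\<mu>\<close>-measure contains most of a fixed compact \<open>K\<close> in the sense of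
  \<open>m\<close>. This part of \<open>K\<close> and its translate by a small \<open>g\<close> both
  lie in a slight thickening of \<open>K\<close>, which is too small to hold them
  disjointly.\<close>

lemma translate_overlap:
  assumes "prob_space \<mu>" and \<mu>: "sets \<mu> = sets borel" and ac: "absolutely_continuous \<mu> m"
  obtains \<delta> U where "0 < \<delta>" "open U" "0 \<in> U"
    "\<And>E g. E \<in> sets borel \<Longrightarrow> 1 - \<delta> < measure \<mu> E \<Longrightarrow> g \<in> U \<Longrightarrow> \<exists>x\<in>E. g + x \<in> E"
proof -
  interpret \<mu>: prob_space \<mu> by fact
  have sp: "space \<mu> = UNIV" using sets_eq_imp_space_eq[OF \<mu>] by simp
  obtain K where K: "compact K" "0 < emeasure m K" by (rule compact_positive)
  have KB: "K \<in> sets borel" using K by (simp add: borel_compact)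
  define k where "k = measure m K"
  have k: "emeasure m K = ennreal k" "0 < k"
    using compact_finite[OF K(1)] K(2) by (auto simp: k_def measure_def enn2real_positive_iff)
  \<comment> \<open>Absolute continuity in epsilon-delta form. Counterexamples for
    \<open>(1/2)^i\<close> have summable complements, so by Borel-Cantelli almost every point lies
    in all but finitely many of them. Their tail intersections within \<open>K\<close> then increase
    to almost all of \<open>K\<close>, although each has measure at most
    \<open>3/4 * k\<close>.\<close>
  have "\<exists>\<delta>>0. \<forall>E\<in>sets borel. 1 - \<delta> < measure \<mu> E \<longrightarrow> ennreal (3/4 * k) < emeasure m (E \<inter> K)"
  proof (rule ccontr)
    assume contra: "\<not> ?thesis"
    have "\<exists>E\<in>sets borel. 1 - (1/2)^i < measure \<mu> E \<and> emeasure m (E \<inter> K) \<le> ennreal (3/4 * k)" for i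
    proof -
      have "0 < (1/2 :: real)^i" by simp
      with contra obtain E where "E \<in> sets borel" "1 - (1/2)^i < measure \<mu> E"
        "\<not> ennreal (3/4 * k) < emeasure m (E \<inter> K)" by blast
      then show ?thesis by (intro bexI[of _ E]) (auto simp: not_less)
    qed
    then have "\<forall>i. \<exists>E. E \<in> sets borel \<and> 1 - (1/2)^i < measure \<mu> E \<and>
        emeasure m (E \<inter> K) \<le> ennreal (3/4 * k)" by blast
    from choice[OF this] obtain E where E [measurable]: "\<And>i. E i \<in> sets borel"
      and E1: "\<And>i. 1 - (1/2)^i < measure \<mu> (E i)"
      and E2: "\<And>i. emeasure m (E i \<inter> K) \<le> ennreal (3/4 * k)" by blast
    have "AE x in \<mu>. eventually (\<lambda>i. x \<in> space \<mu> - (UNIV - E i)) sequentially"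
    proof (rule borel_cantelli_AE1)
      show "summable (\<lambda>i. measure \<mu> (UNIV - E i))"
      proof (rule summable_comparison_test')
        show "summable (\<lambda>i. (1/2)^i :: real)" by (rule summable_geometric) simp
        show "norm (measure \<mu> (UNIV - E i)) \<le> (1/2)^i" for i
          using E1[of i] \<mu>.prob_compl[of "E i"] E by (simp add: sp \<mu>)
      qed
    qed (auto simp: \<mu> \<mu>.emeasure_eq_measure)
    then have AE: "AE x in m. eventually (\<lambda>i. x \<in> E i) sequentially"
      using absolutely_continuous_AE[OF _ ac] by (simp add: \<mu> sp)
    define F where "F j = K \<inter> (\<Inter>i\<in>{j..}. E i)" for j
    have F [measurable]: "F j \<in> sets borel" for j
      using KB unfolding F_def by measurable
    have inc: "incseq F" by (intro monotoneI) (auto simp: F_def)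
    have lim: "(\<lambda>j. emeasure m (F j)) \<longlonglongrightarrow> emeasure m (\<Union>j. F j)"
      using inc by (intro Lim_emeasure_incseq) auto
    have "emeasure m (\<Union>j. F j) = emeasure m K"
      using AE KB by (intro emeasure_eq_AE)
        (auto simp: F_def eventually_sequentially elim!: eventually_mono)
    moreover have "emeasure m (F j) \<le> ennreal (3/4 * k)" for j
    proof -
      have "emeasure m (F j) \<le> emeasure m (E j \<inter> K)"
        using KB by (intro emeasure_mono) (auto simp: F_def)
      with E2[of j] show ?thesis by simp
    qed
    ultimately have "emeasure m K \<le> ennreal (3/4 * k)"
      using lim by (intro LIMSEQ_le_const2[OF lim[unfolded \<open>emeasure m (\<Union>j. F j) = emeasure m K\<close>]]) auto
    then show False using k by (simp add: ennreal_le_iff)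
  qed
  then obtain \<delta> where \<delta>: "0 < \<delta>"
    "\<And>E. E \<in> sets borel \<Longrightarrow> 1 - \<delta> < measure \<mu> E \<Longrightarrow> ennreal (3/4 * k) < emeasure m (E \<inter> K)"
    by blast
  \<comment> \<open>The bound \<open>3/2\<close> is twice \<open>3/4\<close>: two disjoint sets of
    measure above \<open>3/4 * k\<close> do not fit into the thickening.\<close>
  have "emeasure m K < ennreal (3/2 * k)" using k by (simp add: ennreal_less_iff)
  from compact_thickening[OF K(1) this] obtain U where U: "open U" "0 \<in> U"
    and T: "open {u + k + v |u k v. u \<in> U \<and> k \<in> K \<and> v \<in> U}"
      "emeasure m {u + k + v |u k v. u \<in> U \<and> k \<in> K \<and> v \<in> U} < ennreal (3/2 * k)"
      (is "emeasure m ?T < _") by blast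
  show thesis
  proof (rule that[OF \<delta>(1) U])
    fix E g assume E: "E \<in> sets borel" "1 - \<delta> < measure \<mu> E" and g: "g \<in> U"
    let ?A = "E \<inter> K"
    let ?gA = "(\<lambda>x. - g + x) -` ?A"
    have A: "?A \<in> sets borel" using E KB by auto
    have gA: "?gA \<in> sets borel"
      using measurable_sets[OF measurable_translations(1) A] by simp
    have "?A \<inter> ?gA \<noteq> {}"
    proof
      assume dis: "?A \<inter> ?gA = {}"
      have "?A \<subseteq> ?T"
      proof
        fix x assume "x \<in> ?A"
        then show "x \<in> ?T" using U(2)
          by (intro CollectI exI[of _ 0] exI[of _ x]) simp
      qed
      moreover have "?gA \<subseteq> ?T"
      proof
        fix x assume "x \<in> ?gA"
        moreover have "x = g + (- g + x) + 0" by (simp add: add.assoc[symmetric])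
        ultimately show "x \<in> ?T" using g U(2) by blast
      qed
      ultimately have "emeasure m (?A \<union> ?gA) \<le> emeasure m ?T"
        using T(1) by (intro emeasure_mono) auto
      moreover have "emeasure m (?A \<union> ?gA) = emeasure m ?A + emeasure m ?A"
        using plus_emeasure[of ?A m ?gA] A gA dis emeasure_left_vimage[OF A] by simp
      moreover have "ennreal (3/4 * k) + ennreal (3/4 * k) < emeasure m ?A + emeasure m ?A"
        using \<delta>(2)[OF E] by (intro add_strict_mono)
      ultimately show False
        using T(2) k by (simp flip: ennreal_plus)
    qed
    then obtain x where "x \<in> E" "- g + x \<in> E" by auto
    then show "\<exists>x\<in>E. g + x \<in> E"
      by (intro bexI[of _ "- g + x"]) (simp_all add: add.assoc[symmetric])
  qed
qed

end

section \<open>The logarithm of the modular function\<close>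

locale modular = haar m for m :: "'a::{topological_group_add, t2_space, second_countable_topology} measure" +
  fixes \<Delta> :: "'a \<Rightarrow> real"
  assumes modular: "modular_function m \<Delta>"
begin

definition logmod :: "'a \<Rightarrow> real" where "logmod g = ln (\<Delta> g)"

lemma \<Delta>_pos: "0 < \<Delta> g"
  using modular by (simp add: modular_function_def)

lemma emeasure_right_image:
  "E \<in> sets borel \<Longrightarrow> emeasure m ((\<lambda>x. x + g) ` E) = ennreal (\<Delta> g) * emeasure m E"
  using modular by (simp add: modular_function_def)

lemma \<Delta>_add: "\<Delta> (g + h) = \<Delta> g * \<Delta> h"
proof -
  obtain K where K: "compact K" "0 < emeasure m K" by (rule compact_positive)
  have KB: "K \<in> sets borel" using K by (simp add: borel_compact)
  have "(\<lambda>x. x + g) ` K \<in> sets borel"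
    using measurable_sets[OF measurable_translations(2)[of "- g"] KB]
    by (simp add: translation_image_eq_vimage)
  then have "emeasure m ((\<lambda>x. x + h) ` (\<lambda>x. x + g) ` K) = ennreal (\<Delta> g * \<Delta> h) * emeasure m K"
    using KB \<Delta>_pos[of g] \<Delta>_pos[of h]
    by (simp add: emeasure_right_image ennreal_mult mult_ac)
  moreover have "(\<lambda>x. x + h) ` (\<lambda>x. x + g) ` K = (\<lambda>x. x + (g + h)) ` K"
    by (simp add: image_image add.assoc)
  ultimately have "ennreal (\<Delta> (g + h)) * emeasure m K = ennreal (\<Delta> g * \<Delta> h) * emeasure m K"
    by (simp only: emeasure_right_image[OF KB])
  then have "emeasure m K * ennreal (\<Delta> (g + h)) = emeasure m K * ennreal (\<Delta> g * \<Delta> h)"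
    by (simp only: mult.commute)
  then show ?thesis
    using K(2) compact_finite[OF K(1)] \<Delta>_pos[of g] \<Delta>_pos[of h] \<Delta>_pos[of "g + h"]
    by (auto simp: ennreal_mult_cancel_left less_imp_le)
qed

lemma logmod_add: "logmod (g + h) = logmod g + logmod h"
  using \<Delta>_pos[of g] \<Delta>_pos[of h] by (simp add: logmod_def \<Delta>_add ln_mult)

lemma logmod_zero: "logmod 0 = 0"
  using logmod_add[of 0 0] by simp

lemma logmod_minus: "logmod (- g) = - logmod g"
  using logmod_add[of "- g" g] by (simp add: logmod_zero)

text \<open>Continuity at the unit. For small \<open>g\<close> the right translate of
  \<open>K\<close> lies in a thickening of measure below \<open>exp e\<close> times that of
  \<open>K\<close>, which bounds \<open>logmod g\<close> from above. Making the neighbourhood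
  symmetric gives the lower bound.\<close>

lemma logmod_small:
  assumes "0 < e"
  obtains U where "open U" "0 \<in> U" "\<And>g. g \<in> U \<Longrightarrow> \<bar>logmod g\<bar> < e"
proof -
  obtain K where K: "compact K" "0 < emeasure m K" by (rule compact_positive)
  have KB: "K \<in> sets borel" using K by (simp add: borel_compact)
  define k where "k = measure m K"
  have k: "emeasure m K = ennreal k" "0 < k"
    using compact_finite[OF K(1)] K(2) by (auto simp: k_def measure_def enn2real_positive_iff)
  have "emeasure m K < ennreal (exp e * k)" using k assms by (simp add: ennreal_less_iff)
  from compact_thickening[OF K(1) this] obtain U where U: "open U" "0 \<in> U"
    and T: "open {u + k + v |u k v. u \<in> U \<and> k \<in> K \<and> v \<in> U}"
      "emeasure m {u + k + v |u k v. u \<in> U \<and> k \<in> K \<and> v \<in> U} < ennreal (exp e * k)"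
      (is "emeasure m ?T < _") by blast
  have less: "logmod g < e" if "g \<in> U" for g
  proof -
    have "x + g \<in> ?T" if "x \<in> K" for x
      using U(2) that \<open>g \<in> U\<close>
      by (intro CollectI exI[of _ 0] exI[of _ x] exI[of _ g]) simp
    then have "(\<lambda>x. x + g) ` K \<subseteq> ?T" by blast
    then have "emeasure m ((\<lambda>x. x + g) ` K) \<le> emeasure m ?T"
      using T(1) by (intro emeasure_mono) auto
    then have "ennreal (\<Delta> g * k) < ennreal (exp e * k)"
      using T(2) k \<Delta>_pos[of g] by (simp add: emeasure_right_image[OF KB] ennreal_mult)
    then have "\<Delta> g < exp e" using k by (simp add: ennreal_less_iff \<Delta>_pos less_imp_le)
    then show ?thesis using \<Delta>_pos[of g] ln_less_cancel_iff[of "\<Delta> g" "exp e"] by (simp add: logmod_def)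
  qed
  show thesis
  proof (rule that[of "U \<inter> uminus -` U"])
    show "open (U \<inter> uminus -` U)" using U open_translations(3) by auto
    show "\<bar>logmod g\<bar> < e" if "g \<in> U \<inter> uminus -` U" for g
      using less[of g] less[of "- g"] that by (auto simp: logmod_minus)
  qed (use U in auto)
qed

lemma continuous_logmod: "continuous_on UNIV logmod"
proof -
  have "(logmod \<longlongrightarrow> logmod x) (at x)" for x
  proof (rule tendstoI)
    fix e :: real assume "0 < e"
    then obtain U where U: "open U" "0 \<in> U" "\<And>g. g \<in> U \<Longrightarrow> \<bar>logmod g\<bar> < e"
      by (rule logmod_small) blast
    show "eventually (\<lambda>y. dist (logmod y) (logmod x) < e) (at x)"
      unfolding eventually_at_topological
    proof (intro exI[of _ "(\<lambda>y. x + y) ` U"] conjI ballI impI)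
      fix y assume "y \<in> (\<lambda>y. x + y) ` U"
      then show "dist (logmod y) (logmod x) < e"
        using U(3) by (auto simp: logmod_add dist_real_def)
    qed (use U open_translations(1) in force)+
  qed
  then show ?thesis by (simp add: continuous_on)
qed

text \<open>If \<open>logmod\<close> vanished on \<open>U\<close>, the kernel would be a union of
  translates of \<open>U\<close> and hence open.\<close>

lemma logmod_nonzero:
  assumes ker: "\<not> open {g. \<Delta> g = 1}" and U: "open U" "0 \<in> U"
  obtains g where "g \<in> U" "logmod g \<noteq> 0"
proof -
  have "\<exists>g\<in>U. logmod g \<noteq> 0"
  proof (rule ccontr)
    assume "\<not> ?thesis"
    then have 0: "\<And>g. g \<in> U \<Longrightarrow> logmod g = 0" by auto
    have iff: "\<Delta> g = 1 \<longleftrightarrow> logmod g = 0" for g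
      using \<Delta>_pos[of g] by (simp add: logmod_def)
    have "{g. \<Delta> g = 1} = (\<Union>x\<in>{g. \<Delta> g = 1}. (\<lambda>y. x + y) ` U)"
      using U(2) by (force simp: iff logmod_add 0)
    then show False using ker open_translations(1)[OF U(1)] by (metis (no_types, lifting) open_UN)
  qed
  then show thesis using that by blast
qed

end

section \<open>Return times of characters\<close>

lemma norm_cis_diff: "norm (cis a - cis b) = norm (cis (a - b) - 1)"
proof -
  have "cis a - cis b = cis b * (cis (a - b) - 1)"
    by (simp add: right_diff_distrib cis_mult)
  then show ?thesis by (simp add: norm_mult)
qed

lemma norm_cis_diff_le: "norm (cis a - cis b) \<le> \<bar>cos a - cos b\<bar> + \<bar>sin a - sin b\<bar>"
  using cmod_le[of "cis a - cis b"] by simp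

lemma cos_sin_diff_le:
  "\<bar>cos a - cos b\<bar> \<le> norm (cis (a - b) - 1)" "\<bar>sin a - sin b\<bar> \<le> norm (cis (a - b) - 1)"
  using abs_Re_le_cmod[of "cis a - cis b"] abs_Im_le_cmod[of "cis a - cis b"]
  by (simp_all add: norm_cis_diff)

lemma norm_cis_minus_one_le: "norm (cis a - 1) \<le> 2 * \<bar>a\<bar>"
proof -
  have "norm (cis a - 1) \<le> \<bar>cos a - cos 0\<bar> + \<bar>sin a - sin 0\<bar>"
    using norm_cis_diff_le[of a 0] by simp
  also have "\<bar>sin a - sin 0\<bar> \<le> \<bar>a\<bar>" using abs_sin_x_le_abs_x[of a] by simp
  also have "\<bar>cos a - cos 0\<bar> \<le> \<bar>a\<bar>"
  proof -
    have "cos a - cos 0 = - 2 * (sin (a/2))\<^sup>2"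
      using cos_double_sin[of "a/2"] by simp
    then have "\<bar>cos a - cos 0\<bar> = 2 * \<bar>sin (a/2)\<bar> * \<bar>sin (a/2)\<bar>"
      by (simp add: abs_mult power2_eq_square)
    also have "\<dots> \<le> 2 * \<bar>a/2\<bar> * 1"
      by (intro mult_mono abs_sin_x_le_abs_x) auto
    finally show ?thesis by simp
  qed
  finally show ?thesis by simp
qed

text \<open>Pigeonhole: \<open>s\<close> is classified by the cells of a fine grid containing the points
  \<open>cis (s * \<theta> k)\<close>, and one representative is subtracted for each of the finitely many classes.\<close>

lemma return_times_syndetic:
  fixes \<theta> :: "nat \<Rightarrow> real"
  assumes "0 < e"
  obtains L where "0 < L"
    "\<And>s. \<exists>u. \<bar>s - u\<bar> \<le> L \<and> (\<forall>k<n. norm (cis (u * \<theta> k) - 1) < e)"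
proof -
  \<comment> \<open>The grid has mesh \<open>1 / M\<close>: points in the same cell differ by less
    than \<open>1 / M\<close> in each coordinate, hence by less than \<open>2 / M < e\<close> in
    norm.\<close>
  obtain M :: nat where M: "2 / e < real M" using reals_Archimedean2 by blast
  have M0: "0 < real M"
    using M assms by (meson divide_pos_pos less_trans zero_less_numeral)
  define c where "c s = map (\<lambda>k. (\<lfloor>M * cos (s * \<theta> k)\<rfloor>, \<lfloor>M * sin (s * \<theta> k)\<rfloor>)) [0..<n]" for s
  have fin: "finite (range c)"
  proof (rule finite_subset)
    let ?I = "{- int M..int M} \<times> {- int M..int M}"
    have "\<lfloor>real M * y\<rfloor> \<in> {- int M..int M}" if "-1 \<le> y" "y \<le> 1" for y
    proof -
      have "real M * y \<le> real M * 1" "real M * (-1) \<le> real M * y"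
        using that by (intro mult_left_mono; simp)+
      then show ?thesis by (auto simp: le_floor_iff floor_le_iff)
    qed
    then show "range c \<subseteq> {xs. set xs \<subseteq> ?I \<and> length xs = n}"
      by (auto simp: c_def)
    show "finite {xs. set xs \<subseteq> ?I \<and> length xs = n}"
      by (rule finite_lists_length_eq) simp
  qed
  define r where "r x = (SOME s. c s = x)" for x
  have r: "c (r (c s)) = c s" for s
    unfolding r_def by (rule someI[of _ s]) simp
  \<comment> \<open>The summand 1 keeps \<open>L\<close> positive even if all representatives are
    0.\<close>
  define L where "L = 1 + Max ((\<lambda>x. \<bar>r x\<bar>) ` range c)"
  have rL: "\<bar>r (c s)\<bar> \<le> L - 1" for s
    unfolding L_def using fin by (auto intro!: Max_ge)
  show thesis
  proof (rule that[of L])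
    show "0 < L" using rL[of 0] by simp
    fix s
    have "norm (cis ((s - r (c s)) * \<theta> k) - 1) < e" if "k < n" for k
    proof -
      let ?s = "r (c s)"
      have "c ?s ! k = c s ! k" by (simp add: r)
      then have fl: "\<lfloor>M * cos (s * \<theta> k)\<rfloor> = \<lfloor>M * cos (?s * \<theta> k)\<rfloor>"
          "\<lfloor>M * sin (s * \<theta> k)\<rfloor> = \<lfloor>M * sin (?s * \<theta> k)\<rfloor>"
        using that by (simp_all add: c_def)
      have near: "real M * \<bar>y - z\<bar> < 1" if "\<lfloor>real M * y\<rfloor> = \<lfloor>real M * z\<rfloor>" for y z :: real
      proof -
        have "real M * \<bar>y - z\<bar> = \<bar>real M * y - real M * z\<bar>"
          using M0 by (simp add: abs_mult flip: right_diff_distrib)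
        also have "\<dots> < 1" using that by linarith
        finally show ?thesis .
      qed
      have "real M * norm (cis ((s - ?s) * \<theta> k) - 1)
          \<le> real M * (\<bar>cos (s * \<theta> k) - cos (?s * \<theta> k)\<bar> + \<bar>sin (s * \<theta> k) - sin (?s * \<theta> k)\<bar>)"
        using norm_cis_diff_le[of "s * \<theta> k" "?s * \<theta> k"] M0
        by (simp add: norm_cis_diff left_diff_distrib)
      also have "\<dots> < 2"
        using near[OF fl(1)] near[OF fl(2)] by (simp add: distrib_left)
      also have "2 < real M * e" using M assms by (simp add: pos_divide_less_eq)
      finally show ?thesis using M0 by simp
    qed
    with rL[of s] show "\<exists>u. \<bar>s - u\<bar> \<le> L \<and> (\<forall>k<n. norm (cis (u * \<theta> k) - 1) < e)"
      by (intro exI[of _ "s - r (c s)"]) auto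
  qed
qed

text \<open>If the values of \<open>cis (t * logmod x)\<close> concentrated for all return times \<open>t\<close>, then
  \<open>cis (t * logmod g)\<close> would be close to 1 for these \<open>t\<close> and all \<open>g\<close> near \<open>0\<close>; as the return
  times are syndetic, the same would hold for all real \<open>t\<close>, which forces \<open>logmod g = 0\<close>.\<close>

lemma (in modular) nonconcentrated_return_times:
  assumes ker: "\<not> open {g. \<Delta> g = 1}"
    and \<mu>: "prob_space \<mu>" "sets \<mu> = sets borel" "absolutely_continuous \<mu> m"
  obtains \<tau> where "0 < \<tau>"
    "\<And>(\<theta>::nat \<Rightarrow> real) n e. 0 < e \<Longrightarrow> \<exists>t. \<exists>F\<in>{cos, sin}. (\<forall>k<n. norm (cis (t * \<theta> k) - 1) < e) \<and>
      (\<forall>c. measure \<mu> {x. \<bar>F (t * logmod x) - c\<bar> \<le> 1/20} \<le> 1 - \<tau>)"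
proof -
  interpret \<mu>: prob_space \<mu> by fact
  have sp: "space \<mu> = UNIV" using sets_eq_imp_space_eq[OF \<mu>(2)] by simp
  have [measurable]: "logmod \<in> borel_measurable borel"
    by (rule borel_measurable_continuous_onI[OF continuous_logmod])
  obtain \<delta> U where \<delta>: "0 < \<delta>" and U: "open U" "0 \<in> U"
    and overlap: "\<And>E g. E \<in> sets borel \<Longrightarrow> 1 - \<delta> < measure \<mu> E \<Longrightarrow> g \<in> U \<Longrightarrow> \<exists>x\<in>E. g + x \<in> E"
    by (rule translate_overlap[OF \<mu>]) blast
  show thesis
  \<comment> \<open>Halving \<open>\<delta>\<close> lets the concentration sets of cosine and sine
    intersect in measure above \<open>1 - \<delta>\<close>, as \<open>overlap\<close>
    demands.\<close>
  proof (rule that[of "\<delta> / 2"])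
    show "0 < \<delta> / 2" using \<delta> by simp
    fix \<theta> :: "nat \<Rightarrow> real" and n :: nat and e :: real assume "0 < e"
    then obtain L where L: "0 < L"
      "\<And>s. \<exists>u. \<bar>s - u\<bar> \<le> L \<and> (\<forall>k<n. norm (cis (u * \<theta> k) - 1) < e)"
      by (rule return_times_syndetic[where \<theta> = \<theta> and n = n]) blast
    show "\<exists>t. \<exists>F\<in>{cos, sin}. (\<forall>k<n. norm (cis (t * \<theta> k) - 1) < e) \<and>
      (\<forall>c. measure \<mu> {x. \<bar>F (t * logmod x) - c\<bar> \<le> 1/20} \<le> 1 - \<delta> / 2)"
    proof (rule ccontr)
      assume contra: "\<not> ?thesis"
      have close: "norm (cis (t * logmod g) - 1) \<le> 1/5"
        if t: "\<forall>k<n. norm (cis (t * \<theta> k) - 1) < e" and g: "g \<in> U" for t g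
      proof -
        obtain c where c: "1 - \<delta> / 2 < measure \<mu> {x. \<bar>cos (t * logmod x) - c\<bar> \<le> 1/20}"
          using contra t by (auto simp: not_le)
        obtain d where d: "1 - \<delta> / 2 < measure \<mu> {x. \<bar>sin (t * logmod x) - d\<bar> \<le> 1/20}"
          using contra t by (auto simp: not_le)
        let ?C = "{x. \<bar>cos (t * logmod x) - c\<bar> \<le> 1/20}"
        let ?D = "{x. \<bar>sin (t * logmod x) - d\<bar> \<le> 1/20}"
        have B: "?C \<in> sets borel" "?D \<in> sets borel" by measurable
        have "measure \<mu> (?C \<union> ?D) = measure \<mu> ?C + measure \<mu> ?D - measure \<mu> (?C \<inter> ?D)"
          using B by (intro measure_Un3) (auto simp: \<mu> \<mu>.fmeasurable_eq_sets)
        moreover have "measure \<mu> (?C \<union> ?D) \<le> 1" by simp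
        ultimately have "1 - \<delta> < measure \<mu> (?C \<inter> ?D)" using c d by linarith
        from overlap[OF _ this g] B obtain x where x: "x \<in> ?C" "x \<in> ?D" "g + x \<in> ?C" "g + x \<in> ?D"
          by auto
        have "norm (cis (t * logmod g) - 1) = norm (cis (t * logmod (g + x)) - cis (t * logmod x))"
          by (simp add: norm_cis_diff logmod_add algebra_simps)
        also have "\<dots> \<le> \<bar>cos (t * logmod (g + x)) - cos (t * logmod x)\<bar>
            + \<bar>sin (t * logmod (g + x)) - sin (t * logmod x)\<bar>"
          by (rule norm_cis_diff_le)
        also have "\<dots> \<le> 1/10 + 1/10"
          using x unfolding mem_Collect_eq by (intro add_mono; linarith)
        finally show ?thesis by simp
      qed
      \<comment> \<open>Changing the time by at most \<open>L\<close> moves the phase at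
        \<open>g \<in> V\<close> by at most \<open>1/4\<close>. The total error
        \<open>2 * (1/4) + 1/5\<close> stays below 2, the distance from \<open>cis pi\<close> to
        1.\<close>
      obtain V where V: "open V" "0 \<in> V" "\<And>g. g \<in> V \<Longrightarrow> \<bar>logmod g\<bar> < 1 / (4 * L)"
        by (rule logmod_small[of "1 / (4 * L)"]) (use L(1) in auto)
      obtain g where g: "g \<in> U \<inter> V" "logmod g \<noteq> 0"
        by (rule logmod_nonzero[OF ker, of "U \<inter> V"]) (use U V in auto)
      \<comment> \<open>At time \<open>?s\<close> the character takes the value \<open>-1\<close> at
        \<open>g\<close>, as far from 1 as possible; \<open>u\<close> is a return time near
        \<open>?s\<close>.\<close>
      let ?s = "pi / logmod g"
      obtain u where u: "\<bar>?s - u\<bar> \<le> L" "\<forall>k<n. norm (cis (u * \<theta> k) - 1) < e"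
        using L(2) by blast
      have "norm (cis (?s * logmod g) - 1) \<le> norm (cis (?s * logmod g) - cis (u * logmod g))
          + norm (cis (u * logmod g) - 1)"
        by norm
      also have "norm (cis (?s * logmod g) - cis (u * logmod g)) \<le> 2 * \<bar>(?s - u) * logmod g\<bar>"
        unfolding norm_cis_diff using norm_cis_minus_one_le[of "(?s - u) * logmod g"]
        by (simp only: left_diff_distrib)
      also have "\<bar>(?s - u) * logmod g\<bar> \<le> L * (1 / (4 * L))"
        unfolding abs_mult using u(1) V(3)[of g] g(1) L(1)
        by (intro mult_mono) auto
      also have "norm (cis (u * logmod g) - 1) \<le> 1/5"
        using close[OF u(2)] g by simp
      finally have "norm (cis pi - 1) \<le> 2 * (1/4) + 1/5" using g L(1) by simp
      then show False by simp
    qed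
  qed
qed

section \<open>Level sets with thin boundary layers\<close>

text \<open>Let \<open>a\<close> be the supremum of the levels exceeded with probability at least
  \<open>1 - \<tau> / 2\<close>. Levels above \<open>a\<close> are exceeded with at most this
  probability. The band of radius \<open>\<eta>\<close> around \<open>a\<close> carries at most
  \<open>1 - \<tau>\<close>, so levels up to \<open>a + \<eta>\<close> are still exceeded with
  probability at least \<open>\<tau> / 2\<close>. Of \<open>N\<close> disjoint layers centred in
  between, one has probability at most \<open>1 / N\<close>.\<close>

lemma (in prob_space) balanced_level:
  fixes F :: "'a \<Rightarrow> real"
  assumes F [measurable]: "F \<in> borel_measurable M"
    and bounded: "\<And>x. \<bar>F x\<bar> \<le> 1"
    and spread: "\<And>c. prob {x\<in>space M. \<bar>F x - c\<bar> \<le> \<eta>} \<le> 1 - \<tau>"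
    and "0 < \<tau>" "0 < \<epsilon>" "0 < N" and \<epsilon>: "2 * real N * \<epsilon> \<le> \<eta>"
  obtains s where "\<tau> / 2 \<le> prob {x\<in>space M. s < F x}" "prob {x\<in>space M. s < F x} \<le> 1 - \<tau> / 2"
    "prob {x\<in>space M. \<bar>F x - s\<bar> < \<epsilon>} \<le> 1 / real N"
proof -
  define P where "P s = prob {x\<in>space M. s < F x}" for s
  have anti: "P t \<le> P s" if "s \<le> t" for s t
    unfolding P_def using that by (intro finite_measure_mono) auto
  have \<tau>1: "\<tau> \<le> 1"
    using spread[of 0] measure_nonneg[of M "{x\<in>space M. \<bar>F x - 0\<bar> \<le> \<eta>}"] by linarith
  define S where "S = {s. 1 - \<tau> / 2 \<le> P s}"
  have "P (-2) = 1"
  proof -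
    have "-2 < F x" for x using bounded[of x] by (simp add: abs_le_iff)
    then show ?thesis by (simp add: P_def prob_space)
  qed
  then have S_ne: "-2 \<in> S" using \<open>0 < \<tau>\<close> by (simp add: S_def)
  have S_le: "s \<le> 1" if "s \<in> S" for s
  proof (rule ccontr)
    assume "\<not> s \<le> 1"
    then have "\<not> s < F x" for x using bounded[of x] by (simp add: abs_le_iff)
    then have "P s = 0" by (simp add: P_def)
    then show False using that \<tau>1 by (simp add: S_def)
  qed
  then have bdd: "bdd_above S" by (intro bdd_aboveI[of _ 1])
  define a where "a = Sup S"
  have above: "P s \<le> 1 - \<tau> / 2" if "a < s" for s
  proof -
    have "s \<notin> S" using cSup_upper[OF _ bdd, of s] that by (auto simp: a_def)
    then show ?thesis by (simp add: S_def)
  qed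
  have \<eta>: "0 < \<eta>"
    using \<epsilon> \<open>0 < N\<close> \<open>0 < \<epsilon>\<close> mult_pos_pos[of "2 * real N" \<epsilon>] by linarith
  \<comment> \<open>The supremum need not belong to \<open>S\<close>, so the lower bound is taken at
    \<open>a - \<eta>\<close>, below some element of \<open>S\<close>.\<close>
  have "\<exists>s\<in>S. a - \<eta> < s"
    using \<eta> S_ne bdd by (subst less_cSup_iff[symmetric]) (auto simp: a_def)
  then have low: "1 - \<tau> / 2 \<le> P (a - \<eta>)"
    using anti by (auto simp: S_def intro: order_trans less_imp_le)
  have "P (a - \<eta>) \<le> prob ({x\<in>space M. \<bar>F x - a\<bar> \<le> \<eta>} \<union> {x\<in>space M. a + \<eta> < F x})"
    unfolding P_def by (intro finite_measure_mono) auto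
  also have "\<dots> \<le> prob {x\<in>space M. \<bar>F x - a\<bar> \<le> \<eta>} + P (a + \<eta>)"
    unfolding P_def by (intro measure_Un_le) auto
  finally have high: "\<tau> / 2 \<le> P (a + \<eta>)" using low spread[of a] by simp
  \<comment> \<open>Odd multiples of \<open>\<epsilon>\<close> make neighbouring layers of radius
    \<open>\<epsilon>\<close> disjoint; the last centre is
    \<open>a + (2 * N - 1) * \<epsilon>\<close>, still at most \<open>a + \<eta>\<close>.\<close>
  define s where "s i = a + (2 * real i + 1) * \<epsilon>" for i :: nat
  have s: "a < s i" "s i \<le> a + \<eta>" if "i < N" for i
  proof -
    show "a < s i" using \<open>0 < \<epsilon>\<close> by (simp add: s_def)
    have "(2 * real i + 1) * \<epsilon> \<le> 2 * real N * \<epsilon>"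
      using that \<open>0 < \<epsilon>\<close> by (intro mult_right_mono) auto
    then show "s i \<le> a + \<eta>" using \<epsilon> by (simp add: s_def)
  qed
  let ?B = "\<lambda>i. {x\<in>space M. \<bar>F x - s i\<bar> < \<epsilon>}"
  have "\<exists>i<N. prob (?B i) \<le> 1 / real N"
  proof (rule ccontr)
    assume "\<not> ?thesis"
    then have less: "\<And>i. i < N \<Longrightarrow> 1 / real N < prob (?B i)" by (auto simp: not_le)
    have dis: "disjoint_family_on ?B {..<N}"
      unfolding disjoint_family_on_def
    proof (intro ballI impI)
      fix i j :: nat assume "i \<noteq> j"
      then have "1 \<le> \<bar>real i - real j\<bar>" by linarith
      then have "2 * \<epsilon> \<le> 2 * \<epsilon> * \<bar>real i - real j\<bar>" using \<open>0 < \<epsilon>\<close> by simp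
      also have "\<dots> = \<bar>2 * \<epsilon> * (real i - real j)\<bar>" using \<open>0 < \<epsilon>\<close> by (simp add: abs_mult)
      also have "2 * \<epsilon> * (real i - real j) = s i - s j"
        by (simp add: s_def algebra_simps)
      finally show "?B i \<inter> ?B j = {}" by auto
    qed
    have "(\<Sum>i<N. 1 / real N) < (\<Sum>i<N. prob (?B i))"
      using less \<open>0 < N\<close> by (intro sum_strict_mono) auto
    also have "\<dots> = prob (\<Union>i<N. ?B i)"
      using dis by (intro finite_measure_finite_Union[symmetric]) auto
    also have "\<dots> \<le> 1" by simp
    finally show False using \<open>0 < N\<close> by simp
  qed
  then obtain i where i: "i < N" "prob (?B i) \<le> 1 / real N" by blast
  show thesis
    using that[of "s i"] i above[OF s(1)[OF i(1)]] anti[OF s(2)[OF i(1)]] high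
    by (simp add: P_def)
qed

section \<open>Failure of strong ergodicity\<close>

theorem theorem1p2:
  fixes \<Gamma>\<^sub>0 \<Pi>\<^sub>0 :: "'a::{topological_group_add, t2_space, second_countable_topology} set"
    and m \<mu> :: "'a measure"
  assumes "locally_compact_space (euclidean :: 'a topology)"
    and "\<not> almost_unimodular TYPE('a)"
    and "is_subgroup \<Gamma>\<^sub>0" and "countable \<Gamma>\<^sub>0"
    and "is_subgroup \<Pi>\<^sub>0" and "countable \<Pi>\<^sub>0"
    and "left_haar_measure m"
    and "prob_space \<mu>" and "sets \<mu> = sets borel"
    and "absolutely_continuous m \<mu>" and "absolutely_continuous \<mu> m"
  shows "\<not> strongly_ergodic \<mu> (two_sided_relation \<Gamma>\<^sub>0 \<Pi>\<^sub>0)"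
proof -
  interpret \<mu>: prob_space \<mu> by fact
  interpret haar m using assms by unfold_locales
  obtain \<Delta> where \<Delta>: "modular_function m \<Delta>" by (rule modular_function_exists)
  interpret modular m \<Delta> using \<Delta> by unfold_locales
  \<comment> \<open>Almost unimodularity is existential in the measure and the modular function, so
    its negation applies to the present \<open>m\<close> and \<open>\<Delta>\<close>.\<close>
  have ker: "\<not> open {g. \<Delta> g = 1}"
    using assms(2) \<Delta> haar by (auto simp: almost_unimodular_def)
  have sets_\<mu> [simp, measurable_cong]: "sets \<mu> = sets borel" by fact
  have sp [simp]: "space \<mu> = UNIV" using sets_eq_imp_space_eq[OF sets_\<mu>] by simp
  have [measurable]: "logmod \<in> borel_measurable borel"
    by (rule borel_measurable_continuous_onI[OF continuous_logmod])
  \<comment> \<open>These are the possible changes of \<open>logmod\<close> along the relation. The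
    set is non-empty, so \<open>from_nat_into\<close> enumerates it exactly, possibly with
    repetitions.\<close>
  define \<Lambda> where "\<Lambda> = (\<lambda>(\<gamma>, \<pi>). logmod \<gamma> + logmod \<pi>) ` (\<Gamma>\<^sub>0 \<times> \<Pi>\<^sub>0)"
  have \<Lambda>: "countable \<Lambda>" "\<Lambda> \<noteq> {}"
    using assms(3-6) by (auto simp: \<Lambda>_def is_subgroup_def)
  define \<theta> where "\<theta> = from_nat_into \<Lambda>"
  have range_\<theta>: "range \<theta> = \<Lambda>" using \<Lambda> by (simp add: \<theta>_def)
  obtain \<tau> where \<tau>: "0 < \<tau>" and spread:
    "\<And>(\<theta>::nat \<Rightarrow> real) n e. 0 < e \<Longrightarrow> \<exists>t. \<exists>F\<in>{cos, sin}. (\<forall>k<n. norm (cis (t * \<theta> k) - 1) < e) \<and>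
      (\<forall>c. measure \<mu> {x. \<bar>F (t * logmod x) - c\<bar> \<le> 1/20} \<le> 1 - \<tau>)"
    by (rule nonconcentrated_return_times[OF ker assms(8,9,11)]) blast
  \<comment> \<open>This makes \<open>2 * Suc n * \<epsilon> n\<close> equal to \<open>1/20\<close>,
    the radius in \<open>spread\<close>, so \<open>balanced_level\<close> applies with
    \<open>Suc n\<close> layers.\<close>
  define \<epsilon> where "\<epsilon> n = 1 / (40 * real (Suc n))" for n
  have \<epsilon>: "0 < \<epsilon> n" "2 * real (Suc n) * \<epsilon> n \<le> 1/20" for n
    by (simp_all add: \<epsilon>_def field_simps)
  have "\<exists>f s. f \<in> borel_measurable borel \<and>
      (\<forall>x y. \<forall>k<n. logmod x = logmod y + \<theta> k \<longrightarrow> \<bar>f x - f y\<bar> < \<epsilon> n) \<and>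
      \<tau> / 2 \<le> measure \<mu> {x. s < f x} \<and> measure \<mu> {x. s < f x} \<le> 1 - \<tau> / 2 \<and>
      measure \<mu> {x. \<bar>f x - s\<bar> < \<epsilon> n} \<le> 1 / real (Suc n)" for n
  proof -
    obtain t F where F: "F \<in> {cos, sin}" and t: "\<forall>k<n. norm (cis (t * \<theta> k) - 1) < \<epsilon> n"
      and sprd: "\<And>c. measure \<mu> {x. \<bar>F (t * logmod x) - c\<bar> \<le> 1/20} \<le> 1 - \<tau>"
      using spread[OF \<epsilon>(1)[of n], of n \<theta>] by blast
    let ?f = "\<lambda>x. F (t * logmod x)"
    have f [measurable]: "?f \<in> borel_measurable borel" using F by auto
    have "\<bar>?f x - ?f y\<bar> < \<epsilon> n" if "k < n" "logmod x = logmod y + \<theta> k" for x y k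
    proof -
      have "\<bar>?f x - ?f y\<bar> \<le> norm (cis (t * logmod x - t * logmod y) - 1)"
        using F cos_sin_diff_le by auto
      also have "t * logmod x - t * logmod y = t * \<theta> k"
        using that by (simp add: algebra_simps)
      finally show ?thesis using t that(1) by fastforce
    qed
    moreover obtain s where "\<tau> / 2 \<le> measure \<mu> {x. s < ?f x}"
      "measure \<mu> {x. s < ?f x} \<le> 1 - \<tau> / 2"
      "measure \<mu> {x. \<bar>?f x - s\<bar> < \<epsilon> n} \<le> 1 / real (Suc n)"
    proof (rule \<mu>.balanced_level[of ?f "1/20" \<tau> "\<epsilon> n" "Suc n"])
      show "\<bar>?f x\<bar> \<le> 1" for x using F by auto
    qed (use sprd \<tau> \<epsilon> in auto)
    ultimately show ?thesis
      using f by (intro exI[of _ ?f] exI[of _ s]) auto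
  qed
  then have "\<forall>n. \<exists>p. fst p \<in> borel_measurable borel \<and>
      (\<forall>x y. \<forall>k<n. logmod x = logmod y + \<theta> k \<longrightarrow> \<bar>fst p x - fst p y\<bar> < \<epsilon> n) \<and>
      \<tau> / 2 \<le> measure \<mu> {x. snd p < fst p x} \<and> measure \<mu> {x. snd p < fst p x} \<le> 1 - \<tau> / 2 \<and>
      measure \<mu> {x. \<bar>fst p x - snd p\<bar> < \<epsilon> n} \<le> 1 / real (Suc n)" by simp
  from choice[OF this] obtain p where
    p: "\<And>n. fst (p n) \<in> borel_measurable borel"
      "\<And>n x y k. k < n \<Longrightarrow> logmod x = logmod y + \<theta> k \<Longrightarrow> \<bar>fst (p n) x - fst (p n) y\<bar> < \<epsilon> n"
      "\<And>n. \<tau> / 2 \<le> measure \<mu> {x. snd (p n) < fst (p n) x}"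
      "\<And>n. measure \<mu> {x. snd (p n) < fst (p n) x} \<le> 1 - \<tau> / 2"
      "\<And>n. measure \<mu> {x. \<bar>fst (p n) x - snd (p n)\<bar> < \<epsilon> n} \<le> 1 / real (Suc n)"
    by blast
  define f where "f n = fst (p n)" for n
  define s where "s n = snd (p n)" for n
  note p = p[folded f_def s_def]
  note p(1)[measurable]
  define A where "A n = {x. s n < f n x}" for n
  have A [measurable]: "A n \<in> sets borel" for n unfolding A_def by measurable
  have "(\<lambda>n. measure \<mu> (sym_diff (A n) (g ` A n))) \<longlonglongrightarrow> 0"
    if g: "g \<in> full_group \<mu> (two_sided_relation \<Gamma>\<^sub>0 \<Pi>\<^sub>0)" for g
  proof -
    \<comment> \<open>Images under \<open>g\<close> become preimages under the measurable inverse
      \<open>h\<close>.\<close>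
    define h where "h = the_inv_into UNIV g"
    from g have bij: "bij g" and h [measurable]: "h \<in> borel_measurable borel"
      and nonsing: "\<And>E. E \<in> sets borel \<Longrightarrow> emeasure \<mu> E = 0 \<Longrightarrow> emeasure \<mu> (g ` E) = 0"
      and AE: "AE x in \<mu>. (g x, x) \<in> two_sided_relation \<Gamma>\<^sub>0 \<Pi>\<^sub>0"
      by (auto simp: full_group_def nonsingular_automorphism_def h_def
          cong: measurable_cong_sets)
    have gh: "g (h y) = y" and hg: "h (g y) = y" for y
      using bij by (auto simp: h_def bij_def f_the_inv_into_f the_inv_into_f_f)
    have image_eq: "g ` E = h -` E" for E
      using gh hg by (auto simp: image_iff) metis
    have "AE x in \<mu>. \<exists>k. logmod x = logmod (g x) + \<theta> k"
      using AE
    proof eventually_elim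
      fix x assume "(g x, x) \<in> two_sided_relation \<Gamma>\<^sub>0 \<Pi>\<^sub>0"
      then obtain \<gamma> \<pi> where "\<gamma> \<in> \<Gamma>\<^sub>0" "\<pi> \<in> \<Pi>\<^sub>0" and x: "x = \<gamma> + g x + \<pi>"
        by (auto simp: two_sided_relation_def)
      then have "logmod \<gamma> + logmod \<pi> \<in> \<Lambda>" by (auto simp: \<Lambda>_def)
      then obtain k where "\<theta> k = logmod \<gamma> + logmod \<pi>"
        unfolding range_\<theta>[symmetric] by auto
      moreover have "logmod x = logmod \<gamma> + logmod (g x) + logmod \<pi>"
        using arg_cong[OF x, of logmod] by (simp add: logmod_add)
      ultimately show "\<exists>k. logmod x = logmod (g x) + \<theta> k" by (intro exI[of _ k]) simp
    qed
    then obtain Z where Z: "emeasure \<mu> Z = 0" "Z \<in> sets borel"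
      "{x. \<not> (\<exists>k. logmod x = logmod (g x) + \<theta> k)} \<subseteq> Z"
      by (auto elim!: AE_E)
    \<comment> \<open>On \<open>Y j\<close> the displacement by \<open>h\<close> is among the first
      \<open>j\<close> elements of the enumeration. Stage \<open>n\<close> controls only those with
      index below \<open>n\<close>, and the \<open>Y j\<close> exhaust the space up to a null
      set.\<close>
    define Y where "Y j = {y. \<exists>k<j. logmod (h y) = logmod y + \<theta> k}" for j
    have Y [measurable]: "Y j \<in> sets borel" for j unfolding Y_def by measurable
    have "emeasure \<mu> (\<Union>j. Y j) = emeasure \<mu> (space \<mu>)"
    proof (rule emeasure_eq_AE)
      \<comment> \<open>The exceptional set \<open>Z\<close> concerns \<open>x\<close>, while
        \<open>Y\<close> is stated at \<open>y = g x\<close>; non-singularity keeps the image of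
        \<open>Z\<close> null.\<close>
      have "g ` Z \<in> null_sets \<mu>"
        using nonsing[OF Z(2,1)] measurable_sets[OF h Z(2)] by (auto simp: image_eq null_sets_def)
      then show "AE y in \<mu>. y \<in> (\<Union>j. Y j) \<longleftrightarrow> y \<in> space \<mu>"
      proof (rule AE_I', intro subsetI)
        fix y assume "y \<in> {y \<in> space \<mu>. \<not> (y \<in> (\<Union>j. Y j) \<longleftrightarrow> y \<in> space \<mu>)}"
        then have y: "y \<notin> (\<Union>j. Y j)" by simp
        have "h y \<in> Z"
        proof (rule ccontr)
          assume "h y \<notin> Z"
          then have "\<exists>k. logmod (h y) = logmod (g (h y)) + \<theta> k" using Z(3) by blast
          then obtain k where "logmod (h y) = logmod y + \<theta> k" by (auto simp: gh)
          then show False using y by (auto simp: Y_def)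
        qed
        then show "y \<in> g ` Z" by (simp add: image_eq)
      qed
    qed auto
    then have Y1: "measure \<mu> (\<Union>j. Y j) = 1" using \<mu>.prob_space by (simp add: measure_def)
    have "incseq Y" by (intro monotoneI) (auto simp: Y_def intro: less_le_trans)
    moreover have "range Y \<subseteq> sets \<mu>" using Y by auto
    ultimately have Ylim: "(\<lambda>j. measure \<mu> (Y j)) \<longlonglongrightarrow> 1"
      using \<mu>.finite_Lim_measure_incseq[of Y] by (simp only: Y1)
    have bound: "measure \<mu> (sym_diff (A n) (g ` A n)) \<le> 1 / real (Suc n) + (1 - measure \<mu> (Y n))" for n
    proof -
      have gA: "g ` A n \<in> sets borel"
        using measurable_sets[OF h A] by (simp add: image_eq)
      \<comment> \<open>For \<open>y \<in> Y n\<close> membership differs only if the level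
        \<open>s n\<close> separates \<open>f n y\<close> from \<open>f n (h y)\<close>. These
        values are less than \<open>\<epsilon> n\<close> apart, so \<open>y\<close> lies in the thin
        layer.\<close>
      have "sym_diff (A n) (g ` A n) \<subseteq> {y. \<bar>f n y - s n\<bar> < \<epsilon> n} \<union> (UNIV - Y n)"
      proof
        fix y assume y: "y \<in> sym_diff (A n) (g ` A n)"
        show "y \<in> {y. \<bar>f n y - s n\<bar> < \<epsilon> n} \<union> (UNIV - Y n)"
        proof (cases "y \<in> Y n")
          case True
          then obtain k where "k < n" "logmod (h y) = logmod y + \<theta> k" by (auto simp: Y_def)
          from p(2)[OF this] have "\<bar>f n (h y) - f n y\<bar> < \<epsilon> n" .
          then show ?thesis using y by (auto simp: image_eq A_def)
        qed simp
      qed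
      then have "measure \<mu> (sym_diff (A n) (g ` A n))
          \<le> measure \<mu> ({y. \<bar>f n y - s n\<bar> < \<epsilon> n} \<union> (UNIV - Y n))"
        by (intro \<mu>.finite_measure_mono) auto
      also have "\<dots> \<le> measure \<mu> {y. \<bar>f n y - s n\<bar> < \<epsilon> n} + measure \<mu> (UNIV - Y n)"
        by (intro measure_Un_le) auto
      also have "measure \<mu> (UNIV - Y n) = 1 - measure \<mu> (Y n)"
        using \<mu>.prob_compl[of "Y n"] by simp
      finally show ?thesis using p(5)[of n] by simp
    qed
    have "(\<lambda>n. 1 / real (Suc n) + (1 - measure \<mu> (Y n))) \<longlonglongrightarrow> 0 + (1 - 1)"
      by (intro tendsto_intros Ylim LIMSEQ_Suc[OF lim_1_over_n])
    then have "(\<lambda>n. 1 / real (Suc n) + (1 - measure \<mu> (Y n))) \<longlonglongrightarrow> 0" by simp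
    then show ?thesis
    proof (rule Lim_null_comparison[rotated])
      show "eventually (\<lambda>n. norm (measure \<mu> (sym_diff (A n) (g ` A n)))
          \<le> 1 / real (Suc n) + (1 - measure \<mu> (Y n))) sequentially"
        unfolding real_norm_def abs_of_nonneg[OF measure_nonneg]
        by (rule always_eventually) (intro allI bound)
    qed
  qed
  then have "almost_invariant_sequence \<mu> (two_sided_relation \<Gamma>\<^sub>0 \<Pi>\<^sub>0) A"
    by (simp add: almost_invariant_sequence_def)
  moreover have "\<not> trivial_sequence \<mu> A"
  proof
    assume "trivial_sequence \<mu> A"
    then have "(\<lambda>n. measure \<mu> (A n) * (1 - measure \<mu> (A n))) \<longlonglongrightarrow> 0"
      by (simp add: trivial_sequence_def)
    \<comment> \<open>Each of the two factors is at least \<open>\<tau> / 2\<close> by the choice of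
      a balanced level.\<close>
    moreover have "\<tau> / 2 * (\<tau> / 2) \<le> measure \<mu> (A n) * (1 - measure \<mu> (A n))" for n
      using p(3,4)[of n] \<tau> by (intro mult_mono) (auto simp: A_def)
    ultimately have "\<tau> / 2 * (\<tau> / 2) \<le> 0"
      by (intro LIMSEQ_le_const) auto
    then show False using mult_pos_pos[of "\<tau> / 2" "\<tau> / 2"] \<tau> by linarith
  qed
  ultimately show ?thesis by (auto simp: strongly_ergodic_def)
qed

end
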